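(* Let $T$ be a finite tree with root $r$ and positive edge weights, let $B>1$ be a real number, and assume that every vertex of $T$ is at distance at most $B/2$ from $r$. Fix an arbitrary depth first search traversal $R_{\mathrm{DFS}}$ of $T$ and let $\mathrm{PDFS}(T)$ be the DFS $B$-exploration obtained from it. Then $\mathrm{cost}(\mathrm{PDFS}(T))\le 10\cdot \mathrm{cost}(C_{\mathrm{opt}}(T))$, where $C_{\mathrm{opt}}(T)$ is a $B$-exploration strategy of $T$ of minimum cost.
   Context: Distances $d(u,v)$ are sums of edge weights along the tree path. A route is a sequence of vertices $(v_0,\dots,v_l)$ with $v_0=v_l=r$ and consecutive vertices adjacent; its length is the sum of the weights of its consecutive edges. A $B$-exploration strategy is a finite sequence of routes, each of length at most $B$, such that every vertex of $T$ is visited by some route; its cost is the sum of the lengths of its routes. A depth first search traversal $R_{\mathrm{DFS}}=(v_0,\dots,v_l)$ is a route (with repetitions) performing a depth first search of $T$ from $r$. The DFS $B$-exploration $\mathrm{PDFS}(T)=(R_1,\dots,R_k)$ is defined iteratively: $j_0=0$; given $j_{i-1}$, let $j_i$ be the largest index $p\le l$, $p\ge j_{i-1}$, with $d(r,v_{j_{i-1}})+\mathrm{len}(v_{j_{i-1}},\dots,v_p)+d(v_p,r)\le B$; $R_i$ is the tree path from $r$ to $v_{j_{i-1}}$, then the walk $(v_{j_{i-1}},\dots,v_{j_i})$, then the tree path from $v_{j_i}$ to $r$; the process stops once $j_i=l$. *)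

theory Defs
  imports Complex_Main
begin

text \<open>
  An undirected graph is given by its vertex set \<open>V\<close> and its set \<open>E\<close> of edges, which are
  two-element sets of vertices; \<open>w\<close> assigns weights to edges.
  A walk is represented by the nonempty list of the vertices it passes through.
\<close>

definition walk :: "'a set \<Rightarrow> 'a set set \<Rightarrow> 'a list \<Rightarrow> bool" where
  "walk V E p \<longleftrightarrow> p \<noteq> [] \<and> set p \<subseteq> V \<and> successively (\<lambda>u v. {u, v} \<in> E) p"

definition path_between :: "'a set \<Rightarrow> 'a set set \<Rightarrow> 'a \<Rightarrow> 'a \<Rightarrow> 'a list \<Rightarrow> bool" where
  "path_between V E u v p \<longleftrightarrow> walk V E p \<and> distinct p \<and> hd p = u \<and> last p = v"

text \<open>The bound on the length says that a cycle has at least three edges.\<close>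

definition cycle :: "'a set \<Rightarrow> 'a set set \<Rightarrow> 'a list \<Rightarrow> bool" where
  "cycle V E c \<longleftrightarrow> walk V E c \<and> length c \<ge> 4 \<and> hd c = last c \<and> distinct (tl c)"

definition tree :: "'a set \<Rightarrow> 'a set set \<Rightarrow> bool" where
  "tree V E \<longleftrightarrow> V \<noteq> {} \<and> (\<forall>e\<in>E. e \<subseteq> V \<and> card e = 2) \<and>
     (\<forall>u\<in>V. \<forall>v\<in>V. \<exists>p. walk V E p \<and> hd p = u \<and> last p = v) \<and>
     (\<nexists>c. cycle V E c)"

definition tree_path :: "'a set \<Rightarrow> 'a set set \<Rightarrow> 'a \<Rightarrow> 'a \<Rightarrow> 'a list" where
  "tree_path V E u v = (THE p. path_between V E u v p)"

definition walk_length :: "('a set \<Rightarrow> real) \<Rightarrow> 'a list \<Rightarrow> real" where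
  "walk_length w p = (\<Sum>i<length p - 1. w {p ! i, p ! Suc i})"

definition tree_dist :: "'a set \<Rightarrow> 'a set set \<Rightarrow> ('a set \<Rightarrow> real) \<Rightarrow> 'a \<Rightarrow> 'a \<Rightarrow> real" where
  "tree_dist V E w u v = walk_length w (tree_path V E u v)"

definition route :: "'a set \<Rightarrow> 'a set set \<Rightarrow> 'a \<Rightarrow> 'a list \<Rightarrow> bool" where
  "route V E r p \<longleftrightarrow> walk V E p \<and> hd p = r \<and> last p = r"

definition exploration_strategy ::
    "'a set \<Rightarrow> 'a set set \<Rightarrow> ('a set \<Rightarrow> real) \<Rightarrow> 'a \<Rightarrow> real \<Rightarrow> 'a list list \<Rightarrow> bool" where
  "exploration_strategy V E w r B C \<longleftrightarrow>
     (\<forall>p\<in>set C. route V E r p \<and> walk_length w p \<le> B) \<and> (\<forall>v\<in>V. \<exists>p\<in>set C. v \<in> set p)"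

definition cost :: "('a set \<Rightarrow> real) \<Rightarrow> 'a list list \<Rightarrow> real" where
  "cost w C = (\<Sum>p\<leftarrow>C. walk_length w p)"

definition optimal_strategy ::
    "'a set \<Rightarrow> 'a set set \<Rightarrow> ('a set \<Rightarrow> real) \<Rightarrow> 'a \<Rightarrow> real \<Rightarrow> 'a list list \<Rightarrow> bool" where
  "optimal_strategy V E w r B C \<longleftrightarrow> is_arg_min (cost w) (exploration_strategy V E w r B) C"

text \<open>
  \<open>dfs E X v R\<close>: with current vertex \<open>v\<close> and set \<open>X\<close> of vertices visited so far (including \<open>v\<close>),
  \<open>R\<close> lists the vertices occupied, beginning and ending in \<open>v\<close>, until the call of depth first
  search at \<open>v\<close> returns. The order in which unvisited neighbours are chosen is arbitrary.
  In rule \<open>explore\<close>, the first entry of \<open>R'\<close> is the \<open>v\<close> reached by backtracking from \<open>u\<close>.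
\<close>

inductive dfs :: "'a set set \<Rightarrow> 'a set \<Rightarrow> 'a \<Rightarrow> 'a list \<Rightarrow> bool" for E where
  finish: "(\<And>u. {v, u} \<in> E \<Longrightarrow> u \<in> X) \<Longrightarrow> dfs E X v [v]"
| explore: "{v, u} \<in> E \<Longrightarrow> u \<notin> X \<Longrightarrow> dfs E (insert u X) u R \<Longrightarrow> dfs E (X \<union> set R) v R'
    \<Longrightarrow> dfs E X v (v # R @ R')"

definition dfs_traversal :: "'a set set \<Rightarrow> 'a \<Rightarrow> 'a list \<Rightarrow> bool" where
  "dfs_traversal E r R \<longleftrightarrow> dfs E {r} r R"

definition segment :: "'a list \<Rightarrow> nat \<Rightarrow> nat \<Rightarrow> 'a list" where
  "segment R j p = map ((!) R) [j..<Suc p]"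

primrec pdfs_index ::
    "'a set \<Rightarrow> 'a set set \<Rightarrow> ('a set \<Rightarrow> real) \<Rightarrow> 'a \<Rightarrow> real \<Rightarrow> 'a list \<Rightarrow> nat \<Rightarrow> nat" where
  "pdfs_index V E w r B R 0 = 0"
| "pdfs_index V E w r B R (Suc i) = (let j = pdfs_index V E w r B R i in
     Max {p. j \<le> p \<and> p \<le> length R - 1 \<and>
       tree_dist V E w r (R ! j) + walk_length w (segment R j p) + tree_dist V E w (R ! p) r \<le> B})"

text \<open>
  The three pieces of a route share their end points, which \<open>tl\<close> keeps from being repeated.
\<close>

definition pdfs_route ::
    "'a set \<Rightarrow> 'a set set \<Rightarrow> ('a set \<Rightarrow> real) \<Rightarrow> 'a \<Rightarrow> real \<Rightarrow> 'a list \<Rightarrow> nat \<Rightarrow> 'a list" where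
  "pdfs_route V E w r B R i =
     (let j = pdfs_index V E w r B R (i - 1); j' = pdfs_index V E w r B R i in
      tree_path V E r (R ! j) @ tl (segment R j j') @ tl (tree_path V E (R ! j') r))"

text \<open>
  If all vertices have distance at most \<open>B / 2\<close> from \<open>r\<close>, the indices strictly increase until they
  reach \<open>length R - 1\<close>: for neighbouring \<open>x\<close> and \<open>y\<close>, going from \<open>r\<close> to \<open>x\<close>, on to \<open>y\<close> and back
  to \<open>r\<close> takes twice the larger of their two depths. So the \<open>LEAST\<close> below is attained.
\<close>

definition PDFS ::
    "'a set \<Rightarrow> 'a set set \<Rightarrow> ('a set \<Rightarrow> real) \<Rightarrow> 'a \<Rightarrow> real \<Rightarrow> 'a list \<Rightarrow> 'a list list" where
  "PDFS V E w r B R =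
     (let k = (LEAST k. k \<ge> 1 \<and> pdfs_index V E w r B R k = length R - 1) in
      map (pdfs_route V E w r B R) [1..<Suc k])"

end

theory Submission
  imports Defs
begin

text \<open>
  Let \<open>s v = B / 2 - depth v\<close>. A route visiting \<open>v\<close> can cover edges of weight at most \<open>s v\<close> below
  \<open>v\<close>. Consequently, if points \<open>z g\<close> of the tree are such that in the subtree of any vertex their
  values \<open>s (z g)\<close> sum up to less than the total edge weight, then every strategy visits each \<open>v\<close>
  more often than there are points below \<open>v\<close>.

  Every walk made of two consecutive segments of the DFS exploration and one more step ascends or
  descends by more than \<open>s z\<close>, where \<open>z\<close> is its highest vertex. The traversal runs through each edge
  at most once in either direction, so the points \<open>z\<close> of every third such walk satisfy the condition above,
  once for ascents and once for descents. Hence the number of breaks of the exploration below \<open>v\<close> is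
  less than six times the number of visits to \<open>v\<close>, and summing over the edges gives even the
  factor 6 for the costs.
\<close>

section \<open>Walks and paths\<close>

lemma walk_nth:
  assumes "walk V E p" and "Suc i < length p"
  shows "{p ! i, p ! Suc i} \<in> E"
  using assms by (auto simp: walk_def successively_conv_nth)

lemma walk_Cons:
  "walk V E (x # p) \<longleftrightarrow> x \<in> V \<and> (p = [] \<or> walk V E p \<and> {x, hd p} \<in> E)"
  by (cases p) (auto simp: walk_def)

lemma walk_append:
  "p \<noteq> [] \<Longrightarrow> q \<noteq> [] \<Longrightarrow> walk V E (p @ q) \<longleftrightarrow> walk V E p \<and> walk V E q \<and> {last p, hd q} \<in> E"
  by (auto simp: walk_def successively_append_iff)

lemma walk_rev: "walk V E (rev p) \<longleftrightarrow> walk V E p"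
  by (auto simp: walk_def insert_commute)

lemma walk_length_simps [simp]:
  "walk_length w [] = 0"
  "walk_length w [x] = 0"
  "walk_length w (x # y # p) = w {x, y} + walk_length w (y # p)"
  by (auto simp: walk_length_def sum.lessThan_Suc_shift simp del: sum.lessThan_Suc)

lemma walk_length_append_tl:
  assumes "p \<noteq> []" and "q \<noteq> []" and "last p = hd q"
  shows "walk_length w (p @ tl q) = walk_length w p + walk_length w q"
  using assms
proof (induction p rule: induct_list012)
  case (2 x)
  then show ?case by (cases q) auto
qed auto

lemma walk_length_snoc:
  "p \<noteq> [] \<Longrightarrow> walk_length w (p @ [v]) = walk_length w p + w {last p, v}"
  using walk_length_append_tl[of p "[last p, v]" w] by simp

lemma walk_length_rev: "walk_length w (rev p) = walk_length w p"
proof (induction p rule: induct_list012)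
  case (3 x y p)
  then show ?case
    using walk_length_snoc[of "rev (y # p)" w x] by (simp add: insert_commute)
qed auto

section \<open>Existence and uniqueness of paths\<close>

lemma ex_path_between:
  assumes "walk V E p"
  shows "\<exists>q. path_between V E (hd p) (last p) q"
  using assms
proof (induction p)
  case (Cons x p)
  show ?case
  proof (cases "p = []")
    case True
    then show ?thesis
      using Cons.prems by (intro exI[of _ "[x]"]) (auto simp: path_between_def walk_Cons)
  next
    case False
    then obtain q where q: "path_between V E (hd p) (last p) q" and e: "{x, hd p} \<in> E" "x \<in> V"
      using Cons by (auto simp: walk_Cons)
    show ?thesis
    proof (cases "x \<in> set q")
      case True
      \<comment> \<open>Starting the path at this occurrence of \<open>x\<close> avoids visiting
        \<open>x\<close> twice.\<close>
      then obtain a b where ab: "q = a @ x # b"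
        by (auto simp: in_set_conv_decomp)
      have "walk V E (x # b)"
        using q ab by (cases "a = []") (auto simp: path_between_def walk_append)
      then have "path_between V E x (last p) (x # b)"
        using q ab by (auto simp: path_between_def)
      then show ?thesis using False by auto
    next
      case nin: False
      then have "path_between V E x (last p) (x # q)"
        using q e by (cases q) (auto simp: path_between_def walk_def)
      then show ?thesis using False by auto
    qed
  qed
qed (simp add: walk_def)

text \<open>Follow \<open>p\<close> up to its first vertex \<open>x\<close> on \<open>q\<close> and
  return along \<open>q\<close>. By the choice of \<open>x\<close> no vertex in between
  repeats.\<close>

lemma forking_paths_cycle:
  assumes p: "path_between V E u v (u # p)" and q: "path_between V E u v (u # q)"
    and ne: "p \<noteq> []" "q \<noteq> []" "hd p \<noteq> hd q"
  shows "\<exists>c. cycle V E c"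
proof -
  have wp: "walk V E p" and wq: "walk V E q" and ep: "{u, hd p} \<in> E" and eq: "{u, hd q} \<in> E"
    and u: "u \<in> V"
    using p q ne by (auto simp: path_between_def walk_Cons)
  have dp: "distinct (u # p)" and dq: "distinct (u # q)" and "last p = last q"
    using p q ne by (auto simp: path_between_def)
  then have "\<exists>x\<in>set p. x \<in> set q"
    using ne by (metis last_in_set)
  then obtain p1 x p2 where px: "p = p1 @ x # p2" "x \<in> set q" and p1: "\<forall>y\<in>set p1. y \<notin> set q"
    using split_list_first_prop[of p "\<lambda>x. x \<in> set q"] by blast
  then obtain q1 q2 where qx: "q = q1 @ x # q2"
    by (auto simp: in_set_conv_decomp)
  have a: "walk V E (p1 @ [x])"
    using wp px(1) walk_append[of "p1 @ [x]" p2 V E] by (cases "p2 = []") auto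
  have b: "walk V E (q1 @ [x])"
    using wq qx walk_append[of "q1 @ [x]" q2 V E] by (cases "q2 = []") auto
  have "walk V E (u # q1 @ [x])"
    using b eq u qx by (cases q1) (auto simp: walk_Cons)
  then have "walk V E (rev (u # q1 @ [x]))"
    by (simp only: walk_rev)
  then have c: "walk V E ([x] @ rev q1 @ [u])"
    by simp
  have d: "walk V E (rev q1 @ [u])" "{x, hd (rev q1 @ [u])} \<in> E"
    using c walk_append[of "[x]" "rev q1 @ [u]" V E] by auto
  have "walk V E (u # (p1 @ [x]))"
    using a ep u px by (cases p1) (auto simp: walk_Cons)
  then have e: "walk V E ((u # p1 @ [x]) @ rev q1 @ [u])"
    using d walk_append[of "u # p1 @ [x]" "rev q1 @ [u]" V E] by simp
  \<comment> \<open>Different first steps force a vertex besides \<open>u\<close> and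
    \<open>x\<close>, so this is not a single edge run through in both directions.\<close>
  have "p1 \<noteq> [] \<or> q1 \<noteq> []"
    using ne(3) px qx by auto
  then have "length ((u # p1 @ [x]) @ rev q1 @ [u]) \<ge> 4"
    by (cases p1; cases q1) auto
  moreover have "distinct (tl ((u # p1 @ [x]) @ rev q1 @ [u]))"
    using dp dq px(1) qx p1 by auto
  ultimately have "cycle V E ((u # p1 @ [x]) @ rev q1 @ [u])"
    using e by (simp add: cycle_def)
  then show ?thesis by blast
qed

text \<open>Where both paths continue, different next vertices would close a cycle by
  \<open>forking_paths_cycle\<close>.\<close>

lemma path_between_unique:
  assumes "\<nexists>c. cycle V E c" and "path_between V E u v p" and "path_between V E u v q"
  shows "p = q"
  using assms(2,3)
proof (induction p arbitrary: u q)
  case Nil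
  then show ?case by (simp add: path_between_def walk_def)
next
  case (Cons a p)
  have a: "a = u" using Cons.prems by (simp add: path_between_def)
  obtain q' where q: "q = u # q'"
    using Cons.prems by (cases q) (auto simp: path_between_def walk_def)
  show ?case
  proof (cases "p = [] \<or> q' = []")
    case True
    then have "u = v" using Cons.prems a q by (auto simp: path_between_def)
    then have "p = []" "q' = []"
      using Cons.prems a q by (auto simp: path_between_def split: if_splits)
    then show ?thesis using a q by simp
  next
    case False
    then have "hd p = hd q'"
      using forking_paths_cycle[of V E u v p q'] Cons.prems a q assms(1) by auto
    moreover have "path_between V E (hd p) v p" "path_between V E (hd q') v q'"
      using Cons.prems False q by (auto simp: path_between_def walk_Cons)
    ultimately show ?thesis using Cons.IH a q by auto
  qed
qed

section \<open>Rooted trees\<close>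

locale rooted_tree =
  fixes V :: "'a set" and E :: "'a set set" and r :: 'a
  assumes tree: "tree V E" and finite_V [simp]: "finite V" and root [simp]: "r \<in> V"
begin

lemma edge_in_V: "{u, v} \<in> E \<Longrightarrow> u \<in> V \<and> v \<in> V \<and> u \<noteq> v"
  using tree by (fastforce simp: tree_def)

lemma tree_path_eq: "path_between V E u v p \<Longrightarrow> tree_path V E u v = p"
  unfolding tree_path_def
  using tree by (intro the_equality) (auto simp: tree_def intro: path_between_unique)

lemma path_between_tree_path:
  assumes "u \<in> V" and "v \<in> V"
  shows "path_between V E u v (tree_path V E u v)"
proof -
  obtain p where "path_between V E u v p"
    using assms tree ex_path_between unfolding tree_def by metis
  then show ?thesis using tree_path_eq by simp
qed

lemma tree_path_rev:
  assumes "u \<in> V" and "v \<in> V"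
  shows "tree_path V E v u = rev (tree_path V E u v)"
  using path_between_tree_path[OF assms]
  by (intro tree_path_eq) (auto simp: path_between_def walk_rev hd_rev last_rev)

definition anc :: "'a \<Rightarrow> 'a set" where "anc v = set (tree_path V E r v)"

text \<open>For \<open>v = r\<close> this is the last entry of an empty list, an unspecified value,
  hence the recurring condition \<open>v \<noteq> r\<close>.\<close>

definition parent :: "'a \<Rightarrow> 'a" where "parent v = last (butlast (tree_path V E r v))"

definition subtree :: "'a \<Rightarrow> 'a set" where "subtree v = {u \<in> V. v \<in> anc u}"

lemma tree_path_root: "tree_path V E r r = [r]"
  by (intro tree_path_eq) (auto simp: path_between_def walk_def)

lemma anc_root [simp]: "anc r = {r}"
  by (simp add: anc_def tree_path_root)

lemma anc_subset: "v \<in> V \<Longrightarrow> anc v \<subseteq> V"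
  using path_between_tree_path[of r v] by (auto simp: anc_def path_between_def walk_def)

lemma finite_anc [simp]: "finite (anc v)"
  by (simp add: anc_def)

text \<open>Deleting the last vertex of the path to \<open>v\<close> leaves a path to the parent,
  which uniqueness identifies as the tree path.\<close>

lemma
  assumes "v \<in> V" and "v \<noteq> r"
  shows tree_path_parent: "tree_path V E r v = tree_path V E r (parent v) @ [v]"
    and parent_in_V [simp]: "parent v \<in> V"
    and parent_edge: "{parent v, v} \<in> E"
    and not_anc_parent [simp]: "v \<notin> anc (parent v)"
proof -
  define p where "p = tree_path V E r v"
  have p: "path_between V E r v p"
    unfolding p_def by (rule path_between_tree_path) (use assms in auto)
  define q where "q = butlast p"
  have pq: "p = q @ [v]"
    using p by (auto simp: q_def path_between_def walk_def)
  have q: "q \<noteq> []" using p assms(2) pq by (auto simp: path_between_def)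
  have pv: "parent v = last q" by (simp add: parent_def q_def p_def)
  have "path_between V E r (parent v) q"
    using p pq q pv by (auto simp: path_between_def walk_append)
  then have tq: "tree_path V E r (parent v) = q" by (rule tree_path_eq)
  show "tree_path V E r v = tree_path V E r (parent v) @ [v]" using tq pq by (simp add: p_def)
  show "parent v \<in> V" using q p pq pv by (auto simp: path_between_def walk_def)
  show "{parent v, v} \<in> E" using q p pq pv by (auto simp: path_between_def walk_append)
  show "v \<notin> anc (parent v)" using p pq tq by (auto simp: anc_def path_between_def)
qed

lemma anc_parent:
  assumes "v \<in> V" and "v \<noteq> r"
  shows "anc v = insert v (anc (parent v))"
  using tree_path_parent[OF assms] by (simp add: anc_def)

lemma tree_induct [consumes 1, case_names root parent]:
  assumes "v \<in> V" and "P r"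
    and "\<And>v. v \<in> V \<Longrightarrow> v \<noteq> r \<Longrightarrow> P (parent v) \<Longrightarrow> P v"
  shows "P v"
  using assms(1)
proof (induction "length (tree_path V E r v)" arbitrary: v rule: less_induct)
  case less
  then show ?case
    using assms(2,3) tree_path_parent[of v] by (cases "v = r") auto
qed

section \<open>The ancestor relation\<close>

lemma root_in_anc: "v \<in> V \<Longrightarrow> r \<in> anc v"
  by (induction rule: tree_induct) (auto simp: anc_parent)

lemma anc_self [simp]: "v \<in> V \<Longrightarrow> v \<in> anc v"
  by (cases "v = r") (auto simp: anc_parent)

lemma anc_trans:
  assumes "v \<in> V" and "u \<in> anc v"
  shows "anc u \<subseteq> anc v"
  using assms by (induction rule: tree_induct) (auto simp: anc_parent)

lemma anc_antisym:
  assumes "v \<in> V" and "u \<in> anc v" and "v \<in> anc u"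
  shows "u = v"
proof (rule ccontr)
  assume "u \<noteq> v"
  then have vr: "v \<noteq> r" using assms by auto
  then have "u \<in> anc (parent v)" using assms \<open>u \<noteq> v\<close> anc_parent by auto
  then have "v \<in> anc (parent v)" using anc_trans[of "parent v" u] assms vr by auto
  then show False using assms(1) vr by simp
qed

lemma anc_linear:
  assumes "z \<in> V" and "u \<in> anc z" and "v \<in> anc z"
  shows "u \<in> anc v \<or> v \<in> anc u"
  using assms by (induction rule: tree_induct) (auto simp: anc_parent)

text \<open>If \<open>v\<close> lies on the path to \<open>u\<close>, cutting that path after
  \<open>v\<close> and appending \<open>u\<close> gives again a path to \<open>u\<close>, so by
  uniqueness \<open>v\<close> is the parent. Otherwise appending \<open>v\<close> to the path to
  \<open>u\<close> yields the path to \<open>v\<close>.\<close>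

lemma edge_cases:
  assumes "{u, v} \<in> E"
  obtains "v \<noteq> r" "parent v = u" | "u \<noteq> r" "parent u = v"
proof -
  have V: "u \<in> V" "v \<in> V" "u \<noteq> v" using edge_in_V[OF assms] by auto
  have pu: "path_between V E r u (tree_path V E r u)"
    using path_between_tree_path V by simp
  show ?thesis
  proof (cases "v \<in> anc u")
    case True
    then obtain a b where ab: "tree_path V E r u = a @ v # b"
      by (auto simp: anc_def in_set_conv_decomp)
    have b: "b \<noteq> []" using pu ab V(3) by (auto simp: path_between_def)
    then have "u \<in> set b" using pu ab by (auto simp: path_between_def)
    then have d: "distinct ((a @ [v]) @ [u])" using pu ab by (auto simp: path_between_def)
    have "walk V E (a @ [v])"
      using pu ab b walk_append[of "a @ [v]" b V E] by (simp add: path_between_def)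
    then have "walk V E ((a @ [v]) @ [u])"
      using assms V walk_append[of "a @ [v]" "[u]" V E]
      by (auto simp: insert_commute walk_Cons)
    moreover have "hd ((a @ [v]) @ [u]) = r"
      using pu ab by (cases a) (auto simp: path_between_def)
    ultimately have "path_between V E r u ((a @ [v]) @ [u])"
      using d by (auto simp: path_between_def)
    then have t: "tree_path V E r u = (a @ [v]) @ [u]" by (rule tree_path_eq)
    then have "parent u = v" by (simp add: parent_def butlast_append)
    moreover have "u \<noteq> r" using t tree_path_root by auto
    ultimately show ?thesis using that by blast
  next
    case False
    then have "path_between V E r v (tree_path V E r u @ [v])"
      using pu assms V
        walk_append[of "tree_path V E r u" "[v]" V E]
      by (auto simp: path_between_def anc_def walk_Cons walk_def hd_append)
    then have "tree_path V E r v = tree_path V E r u @ [v]" by (rule tree_path_eq)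
    then have "parent v = u" using pu by (simp add: parent_def path_between_def)
    moreover have "v \<noteq> r" using False root_in_anc V by auto
    ultimately show ?thesis using that by blast
  qed
qed

section \<open>Subtrees and the edges entering them\<close>

lemma subtree_subset: "subtree v \<subseteq> V"
  by (auto simp: subtree_def)

lemma finite_subtree [simp]: "finite (subtree v)"
  using subtree_subset finite_V by (rule finite_subset)

lemma subtree_self: "v \<in> V \<Longrightarrow> v \<in> subtree v"
  by (simp add: subtree_def)

lemma subtree_root: "subtree r = V"
  using root_in_anc by (auto simp: subtree_def)

lemma root_not_in_subtree: "v \<noteq> r \<Longrightarrow> r \<notin> subtree v"
  by (simp add: subtree_def)

lemma subtree_trans: "u \<in> subtree v \<Longrightarrow> subtree u \<subseteq> subtree v"
  using anc_trans by (auto simp: subtree_def)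

lemma parent_in_subtree:
  assumes "u \<in> V" and "u \<noteq> r" and "parent u \<in> subtree v"
  shows "u \<in> subtree v - {v}"
  using assms by (auto simp: subtree_def anc_parent)

lemma edge_into_subtree:
  assumes "{a, b} \<in> E" and "a \<notin> subtree v" and "b \<in> subtree v"
  shows "b = v \<and> v \<noteq> r \<and> parent v = a"
proof -
  have V: "a \<in> V" "b \<in> V" using edge_in_V assms by auto
  show ?thesis
  proof (cases rule: edge_cases[OF assms(1)])
    case 1
    then have "anc b = insert b (anc a)" using V anc_parent by auto
    then show ?thesis using 1 assms V by (auto simp: subtree_def)
  next
    case 2
    then have "a \<in> subtree v" using parent_in_subtree[of a v] V assms by auto
    then show ?thesis using assms by simp
  qed
qed

text \<open>Membership in the subtree changes within a single step, and
  \<open>edge_into_subtree\<close> leaves only the edge above \<open>v\<close> for it.\<close>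

lemma walk_into_subtree:
  assumes "walk V E p" and "a \<le> b" and "b < length p" and "p ! a \<notin> subtree v" and "p ! b \<in> subtree v"
  obtains i where "a \<le> i" "i < b" "p ! Suc i = v" "v \<noteq> r" "parent v = p ! i"
proof -
  have "\<exists>i. a \<le> i \<and> i < b \<and> p ! i \<notin> subtree v \<and> p ! Suc i \<in> subtree v"
    using assms(2,4,5)
  proof (induction b rule: dec_induct)
    case (step n)
    then show ?case by (cases "p ! n \<in> subtree v") (auto intro: less_SucI)
  qed simp
  then obtain i where i: "a \<le> i" "i < b" "p ! i \<notin> subtree v" "p ! Suc i \<in> subtree v"
    by blast
  then have "{p ! i, p ! Suc i} \<in> E" using walk_nth[OF assms(1)] assms(3) by simp
  then show ?thesis using edge_into_subtree i that by metis
qed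

lemma walk_out_of_subtree:
  assumes "walk V E p" and "a \<le> b" and "b < length p" and "p ! a \<in> subtree v" and "p ! b \<notin> subtree v"
  obtains i where "a \<le> i" "i < b" "p ! i = v" "v \<noteq> r" "parent v = p ! Suc i"
proof -
  have "\<exists>i. a \<le> i \<and> i < b \<and> p ! i \<in> subtree v \<and> p ! Suc i \<notin> subtree v"
    using assms(2,4,5)
  proof (induction b rule: dec_induct)
    case (step n)
    then show ?case by (cases "p ! n \<in> subtree v") (auto intro: less_SucI)
  qed simp
  then obtain i where i: "a \<le> i" "i < b" "p ! i \<in> subtree v" "p ! Suc i \<notin> subtree v"
    by blast
  then have "{p ! Suc i, p ! i} \<in> E"
    using walk_nth[OF assms(1), of i] assms(3) by (simp add: insert_commute)
  then show ?thesis using edge_into_subtree i that by metis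
qed

end

section \<open>Weights and depths\<close>

locale weighted_rooted_tree = rooted_tree V E r
  for V :: "'a set" and E :: "'a set set" and r :: 'a +
  fixes w :: "'a set \<Rightarrow> real"
  assumes w_pos: "e \<in> E \<Longrightarrow> w e > 0"
begin

text \<open>Identifying an edge with its lower end turns sums over edges into sums over vertices
  other than \<open>r\<close>.\<close>

definition wt :: "'a \<Rightarrow> real" where "wt u = w {parent u, u}"

definition depth :: "'a \<Rightarrow> real" where "depth v = tree_dist V E w r v"

definition weight_below :: "'a \<Rightarrow> real" where
  "weight_below v = (\<Sum>u\<in>subtree v - {v}. wt u)"

section \<open>Depths as sums of edge weights\<close>

lemma wt_pos: "u \<in> V \<Longrightarrow> u \<noteq> r \<Longrightarrow> wt u > 0"
  using parent_edge w_pos by (simp add: wt_def)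

lemma wt_nonneg_below:
  assumes "u \<in> subtree v - {v}"
  shows "0 \<le> wt u"
proof -
  have "u \<in> V" "u \<noteq> r" using assms subtree_subset root_not_in_subtree[of v] by auto
  then show ?thesis using wt_pos[of u] by simp
qed

lemma depth_root [simp]: "depth r = 0"
  by (simp add: depth_def tree_dist_def tree_path_root)

lemma depth_parent:
  assumes "v \<in> V" and "v \<noteq> r"
  shows "depth v = depth (parent v) + wt v"
proof -
  have "path_between V E r (parent v) (tree_path V E r (parent v))"
    using path_between_tree_path assms by simp
  then show ?thesis
    using tree_path_parent[OF assms]
    by (simp add: depth_def tree_dist_def wt_def walk_length_snoc path_between_def walk_def)
qed

lemma tree_dist_to_root: "v \<in> V \<Longrightarrow> tree_dist V E w v r = depth v"
  using tree_path_rev[of r v] by (simp add: depth_def tree_dist_def walk_length_rev)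

lemma depth_sum: "v \<in> V \<Longrightarrow> depth v = (\<Sum>u\<in>anc v - {r}. wt u)"
proof (induction rule: tree_induct)
  case (parent v)
  then have "anc v - {r} = insert v (anc (parent v) - {r})" "v \<notin> anc (parent v) - {r}"
    using anc_parent by auto
  then show ?case using parent depth_parent by simp
qed simp

lemma sum_wt_between:
  assumes "z \<in> subtree v"
  shows "(\<Sum>u\<in>{u \<in> subtree v - {v}. z \<in> subtree u}. wt u) = depth z - depth v"
proof -
  have z: "z \<in> V" "v \<in> anc z" using assms by (auto simp: subtree_def)
  have v: "v \<in> V" "anc v \<subseteq> anc z" using z anc_subset anc_trans by auto
  \<comment> \<open>Both sides are the path from \<open>v\<close> to \<open>z\<close> without
    \<open>v\<close>, as the ancestors of \<open>z\<close> are linearly ordered.\<close>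
  have "{u \<in> subtree v - {v}. z \<in> subtree u} = (anc z - {r}) - (anc v - {r})"
  proof (rule set_eqI)
    fix u
    show "u \<in> {u \<in> subtree v - {v}. z \<in> subtree u} \<longleftrightarrow> u \<in> (anc z - {r}) - (anc v - {r})"
      using z v anc_subset[of z] anc_linear[of z u v] anc_antisym[of v u] anc_self[of v]
        root_in_anc[of v]
      by (auto simp: subtree_def)
  qed
  moreover have "(\<Sum>u\<in>(anc z - {r}) - (anc v - {r}). wt u) = depth z - depth v"
    using z v by (subst sum_diff) (auto simp: depth_sum)
  ultimately show ?thesis by simp
qed

text \<open>Double counting: after exchanging the sums, each point \<open>z g\<close> in the subtree
  of \<open>v\<close> collects the edges between \<open>v\<close> and itself.\<close>

lemma sum_subtree_count:
  assumes "finite G" and "v \<in> V"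
  shows "(\<Sum>u\<in>subtree v - {v}. wt u * card {g \<in> G. z g \<in> subtree u}) =
    (\<Sum>g\<in>{g \<in> G. z g \<in> subtree v}. depth (z g) - depth v)"
proof -
  have "(\<Sum>u\<in>subtree v - {v}. wt u * card {g \<in> G. z g \<in> subtree u}) =
    (\<Sum>u\<in>subtree v - {v}. \<Sum>g\<in>{g \<in> G. z g \<in> subtree u}. wt u)"
    by (simp add: mult.commute)
  also have "\<dots> = (\<Sum>u\<in>subtree v - {v}. \<Sum>g\<in>G. if z g \<in> subtree u then wt u else 0)"
    using assms(1) by (simp add: sum.If_cases Int_def)
  also have "\<dots> = (\<Sum>g\<in>G. \<Sum>u\<in>subtree v - {v}. if z g \<in> subtree u then wt u else 0)"
    by (rule sum.swap)
  also have "\<dots> = (\<Sum>g\<in>G. \<Sum>u\<in>{u \<in> subtree v - {v}. z g \<in> subtree u}. wt u)"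
    by (rule sum.cong, rule refl, rule sum.inter_filter[symmetric]) simp
  also have "\<dots> = (\<Sum>g\<in>G. if z g \<in> subtree v then depth (z g) - depth v else 0)"
  proof (intro sum.cong refl)
    fix g
    show "(\<Sum>u\<in>{u \<in> subtree v - {v}. z g \<in> subtree u}. wt u) =
      (if z g \<in> subtree v then depth (z g) - depth v else 0)"
    proof (cases "z g \<in> subtree v")
      case False
      then have "{u \<in> subtree v - {v}. z g \<in> subtree u} = {}"
        using subtree_trans by blast
      then show ?thesis using False by (simp only: sum.empty if_False)
    qed (simp only: sum_wt_between if_True)
  qed
  also have "\<dots> = (\<Sum>g\<in>{g \<in> G. z g \<in> subtree v}. depth (z g) - depth v)"
    using assms(1) by (simp add: sum.If_cases Int_def)
  finally show ?thesis .
qed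

subsection \<open>Descent and ascent of walks\<close>

definition down :: "'a list \<Rightarrow> nat \<Rightarrow> bool" where
  "down p i \<longleftrightarrow> p ! Suc i \<noteq> r \<and> parent (p ! Suc i) = p ! i"

definition up :: "'a list \<Rightarrow> nat \<Rightarrow> bool" where
  "up p i \<longleftrightarrow> p ! i \<noteq> r \<and> parent (p ! i) = p ! Suc i"

definition descent :: "'a list \<Rightarrow> nat \<Rightarrow> real" where
  "descent p i = (if down p i then wt (p ! Suc i) else 0)"

definition ascent :: "'a list \<Rightarrow> nat \<Rightarrow> real" where
  "ascent p i = (if up p i then wt (p ! i) else 0)"

text \<open>An edge joins a child with its parent, and the child is strictly deeper, so every step
  goes either down or up and never both.\<close>

lemma
  assumes "walk V E p" and "Suc i < length p"
  shows step_weight: "w {p ! i, p ! Suc i} = descent p i + ascent p i"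
    and step_depth: "depth (p ! Suc i) - depth (p ! i) = descent p i - ascent p i"
    and descent_nonneg: "0 \<le> descent p i"
    and ascent_nonneg: "0 \<le> ascent p i"
    and step_one_way: "descent p i = 0 \<or> ascent p i = 0"
proof -
  have e: "{p ! i, p ! Suc i} \<in> E" using walk_nth assms by blast
  then have V: "p ! i \<in> V" "p ! Suc i \<in> V" using edge_in_V by auto
  have "w {p ! i, p ! Suc i} = descent p i + ascent p i \<and>
    depth (p ! Suc i) - depth (p ! i) = descent p i - ascent p i \<and> 0 \<le> descent p i \<and> 0 \<le> ascent p i \<and>
    (descent p i = 0 \<or> ascent p i = 0)"
  proof (cases rule: edge_cases[OF e])
    case 1
    then have "down p i" by (simp add: down_def)
    moreover have "\<not> up p i"
      using 1 V depth_parent[of "p ! i"] depth_parent[of "p ! Suc i"] wt_pos[of "p ! i"]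
        wt_pos[of "p ! Suc i"] by (auto simp: up_def)
    ultimately show ?thesis
      using 1 V depth_parent[of "p ! Suc i"] wt_pos[of "p ! Suc i"]
      by (simp add: descent_def ascent_def wt_def)
  next
    case 2
    then have "up p i" by (simp add: up_def)
    moreover have "\<not> down p i"
      using 2 V depth_parent[of "p ! i"] depth_parent[of "p ! Suc i"] wt_pos[of "p ! i"]
        wt_pos[of "p ! Suc i"] by (auto simp: down_def)
    ultimately show ?thesis
      using 2 V depth_parent[of "p ! i"] wt_pos[of "p ! i"]
      by (simp add: descent_def ascent_def wt_def insert_commute)
  qed
  then show "w {p ! i, p ! Suc i} = descent p i + ascent p i"
    "depth (p ! Suc i) - depth (p ! i) = descent p i - ascent p i"
    "0 \<le> descent p i" "0 \<le> ascent p i" "descent p i = 0 \<or> ascent p i = 0" by auto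
qed

lemma walk_depth:
  assumes "walk V E p" and "a \<le> b" and "b < length p"
  shows "depth (p ! b) - depth (p ! a) = (\<Sum>i\<in>{a..<b}. descent p i) - (\<Sum>i\<in>{a..<b}. ascent p i)"
proof -
  have "depth (p ! b) - depth (p ! a) = (\<Sum>i\<in>{a..<b}. depth (p ! Suc i) - depth (p ! i))"
    using sum_Suc_diff'[OF assms(2), of "\<lambda>i. depth (p ! i)"] by simp
  also have "\<dots> = (\<Sum>i\<in>{a..<b}. descent p i - ascent p i)"
    using assms by (intro sum.cong refl step_depth) auto
  finally show ?thesis by (simp add: sum_subtractf)
qed

lemma walk_weight:
  assumes "walk V E p" and "b < length p"
  shows "(\<Sum>i\<in>{a..<b}. w {p ! i, p ! Suc i}) =
    (\<Sum>i\<in>{a..<b}. descent p i) + (\<Sum>i\<in>{a..<b}. ascent p i)"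
proof -
  have "(\<Sum>i\<in>{a..<b}. w {p ! i, p ! Suc i}) = (\<Sum>i\<in>{a..<b}. descent p i + ascent p i)"
    using assms by (intro sum.cong refl step_weight) auto
  then show ?thesis by (simp add: sum.distrib)
qed

text \<open>The route starts outside the subtree of \<open>u\<close> and can enter it only through
  the edge above \<open>u\<close>. Hence a route covers the whole path from \<open>r\<close> to
  every vertex that it visits.\<close>

lemma route_mem_subtree:
  assumes "route V E r p" and "v \<in> set p" and "u \<in> anc v" and "u \<noteq> r"
  obtains i where "Suc i < length p" "p ! Suc i = u" "down p i"
proof -
  have p: "walk V E p" "p ! 0 = r" "p \<noteq> []"
    using assms(1) by (auto simp: route_def walk_def hd_conv_nth)
  obtain b where b: "b < length p" "p ! b = v" using assms(2) by (auto simp: in_set_conv_nth)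
  have "v \<in> V" using p assms(2) by (auto simp: walk_def)
  then have "p ! b \<in> subtree u" using assms b by (simp add: subtree_def)
  moreover have "p ! 0 \<notin> subtree u" using root_not_in_subtree assms p by simp
  ultimately obtain i where "i < b" "p ! Suc i = u" "parent u = p ! i"
    using walk_into_subtree[of p 0 b u] p b by auto
  then show ?thesis using that[of i] b assms by (auto simp: down_def)
qed

text \<open>A closed walk ascends as much as it descends, so its length is twice its descent, and
  each visited vertex other than \<open>r\<close> is entered from its parent at least once.\<close>

lemma route_length_ge:
  assumes p: "route V E r p"
  shows "2 * (\<Sum>u\<in>set p - {r}. wt u) \<le> walk_length w p"
proof -
  have wp: "walk V E p" and ends: "p ! 0 = r" "p ! (length p - 1) = r" and ne: "p \<noteq> []"
    using p by (auto simp: route_def walk_def hd_conv_nth last_conv_nth)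
  have sV: "set p \<subseteq> V" using wp by (simp add: walk_def)
  define l where "l = length p - 1"
  have l: "l < length p" using ne by (simp add: l_def)
  have "0 = (\<Sum>i\<in>{0..<l}. descent p i) - (\<Sum>i\<in>{0..<l}. ascent p i)"
    using walk_depth[OF wp, of 0 l] ends l by (simp add: l_def)
  moreover have "walk_length w p = (\<Sum>i\<in>{0..<l}. descent p i) + (\<Sum>i\<in>{0..<l}. ascent p i)"
    using walk_weight[OF wp l, of 0] by (simp add: walk_length_def l_def atLeast0LessThan)
  moreover have "(\<Sum>u\<in>set p - {r}. wt u) \<le> (\<Sum>i\<in>{0..<l}. descent p i)"
  proof -
    let ?D = "{i \<in> {0..<l}. down p i}"
    have "set p - {r} \<subseteq> (\<lambda>i. p ! Suc i) ` ?D"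
    proof
      fix u assume "u \<in> set p - {r}"
      then have "u \<in> set p" "u \<in> anc u" "u \<noteq> r" using sV by auto
      then obtain i where "Suc i < length p" "p ! Suc i = u" "down p i"
        using route_mem_subtree[OF p] by blast
      then show "u \<in> (\<lambda>i. p ! Suc i) ` ?D" by (auto simp: l_def)
    qed
    moreover have nn: "0 \<le> wt (p ! Suc i)" if "i \<in> ?D" for i
    proof -
      have "p ! Suc i \<in> set p" using that by (auto simp: l_def intro: nth_mem)
      then show ?thesis using that sV wt_pos[of "p ! Suc i"] by (auto simp: down_def)
    qed
    ultimately have "(\<Sum>u\<in>set p - {r}. wt u) \<le> (\<Sum>u\<in>(\<lambda>i. p ! Suc i) ` ?D. wt u)"
      by (intro sum_mono2) auto
    \<comment> \<open>A vertex may be entered from its parent several times, hence only an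
      inequality.\<close>
    also have "\<dots> \<le> (\<Sum>i\<in>?D. (wt \<circ> (\<lambda>i. p ! Suc i)) i)"
      using nn by (intro sum_image_le) auto
    also have "\<dots> = (\<Sum>i\<in>{0..<l}. descent p i)"
      unfolding descent_def by (simp add: sum.If_cases Int_def)
    finally show ?thesis .
  qed
  ultimately show ?thesis by linarith
qed

subsection \<open>A lower bound on the number of routes\<close>

text \<open>Routes are counted by position, so a route repeated in \<open>C\<close> counts each
  time, while several passes of one route through \<open>v\<close> count once.\<close>

definition visits :: "'a list list \<Rightarrow> 'a \<Rightarrow> nat" where
  "visits C v = card {i. i < length C \<and> v \<in> set (C ! i)}"

lemma sum_routes_eq_sum_visits:
  assumes "finite X"
  shows "(\<Sum>i\<in>{i. i < length C \<and> P i}. \<Sum>u\<in>X \<inter> set (C ! i). wt u) =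
    (\<Sum>u\<in>X. wt u * card {i. i < length C \<and> P i \<and> u \<in> set (C ! i)})"
proof -
  let ?I = "{i. i < length C \<and> P i}"
  have "(\<Sum>i\<in>?I. \<Sum>u\<in>X \<inter> set (C ! i). wt u) =
    (\<Sum>i\<in>?I. \<Sum>u\<in>X. if u \<in> set (C ! i) then wt u else 0)"
    using assms by (simp add: sum.If_cases)
  also have "\<dots> = (\<Sum>u\<in>X. \<Sum>i\<in>?I. if u \<in> set (C ! i) then wt u else 0)"
    by (rule sum.swap)
  also have "\<dots> = (\<Sum>u\<in>X. wt u * card {i. i < length C \<and> P i \<and> u \<in> set (C ! i)})"
    by (intro sum.cong refl) (simp add: sum.If_cases Int_def mult.commute conj_assoc)
  finally show ?thesis .
qed

lemma cost_ge_sum_visits: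
  assumes "\<forall>p\<in>set C. route V E r p"
  shows "2 * (\<Sum>u\<in>V - {r}. wt u * visits C u) \<le> cost w C"
proof -
  have sub: "(V - {r}) \<inter> set (C ! i) = set (C ! i) - {r}" if "i < length C" for i
  proof -
    have "route V E r (C ! i)" using assms that by simp
    then show ?thesis by (auto simp: route_def walk_def)
  qed
  have "2 * (\<Sum>u\<in>V - {r}. wt u * visits C u) =
    2 * (\<Sum>i\<in>{i. i < length C \<and> True}. \<Sum>u\<in>(V - {r}) \<inter> set (C ! i). wt u)"
    by (subst sum_routes_eq_sum_visits) (simp_all add: visits_def)
  also have "\<dots> = (\<Sum>i\<in>{0..<length C}. 2 * (\<Sum>u\<in>set (C ! i) - {r}. wt u))"
    using sub by (auto simp: sum_distrib_left intro!: sum.cong)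
  also have "\<dots> \<le> (\<Sum>i\<in>{0..<length C}. walk_length w (C ! i))"
    using assms by (intro sum_mono route_length_ge) simp
  also have "\<dots> = cost w C"
    by (simp add: cost_def sum_list_sum_nth)
  finally show ?thesis .
qed

text \<open>Half the length of a route through \<open>v\<close> has to pay for the path from
  \<open>r\<close> to \<open>v\<close> and for all visited vertices below \<open>v\<close>. At most
  \<open>B / 2 - depth v\<close> remains for the latter.\<close>

lemma visits_capacity:
  assumes C: "\<forall>p\<in>set C. route V E r p \<and> walk_length w p \<le> B" and v: "v \<in> V"
  shows "(\<Sum>u\<in>subtree v - {v}. wt u * visits C u) \<le> visits C v * (B / 2 - depth v)"
proof -
  \<comment> \<open>A route that reaches the subtree of \<open>v\<close> visits \<open>v\<close>
    itself, so every visit below \<open>v\<close> belongs to a route counted at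
    \<open>v\<close>.\<close>
  have mem: "v \<in> set (C ! i)" if "i < length C" "u \<in> set (C ! i)" "u \<in> subtree v" for i u
  proof (cases "v = r")
    case True
    have "route V E r (C ! i)" using C that by simp
    then show ?thesis using True by (metis route_def walk_def hd_in_set)
  next
    case False
    have "route V E r (C ! i)" "v \<in> anc u" using C that by (auto simp: subtree_def)
    then obtain j where "Suc j < length (C ! i)" "C ! i ! Suc j = v"
      using route_mem_subtree \<open>u \<in> set (C ! i)\<close> False by blast
    then show ?thesis by (metis nth_mem)
  qed
  let ?I = "{i. i < length C \<and> v \<in> set (C ! i)}"
  have "(\<Sum>u\<in>subtree v - {v}. wt u * visits C u) =
    (\<Sum>u\<in>subtree v - {v}. wt u * card {i. i < length C \<and> v \<in> set (C ! i) \<and> u \<in> set (C ! i)})"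
    unfolding visits_def using mem
    by (intro sum.cong refl arg_cong2[of _ _ _ _ "(*)"] arg_cong[of _ _ card] arg_cong[of _ _ real]) auto
  also have "\<dots> = (\<Sum>i\<in>?I. \<Sum>u\<in>(subtree v - {v}) \<inter> set (C ! i). wt u)"
    by (subst sum_routes_eq_sum_visits) simp_all
  also have "\<dots> \<le> (\<Sum>i\<in>?I. B / 2 - depth v)"
  proof (rule sum_mono)
    fix i assume i: "i \<in> ?I"
    then have p: "route V E r (C ! i)" "walk_length w (C ! i) \<le> B" "set (C ! i) \<subseteq> V"
      using C by (auto simp: route_def walk_def)
    let ?S = "(subtree v - {v}) \<inter> set (C ! i)"
    have "anc v - {r} \<subseteq> set (C ! i)"
    proof
      fix u assume "u \<in> anc v - {r}"
      then obtain j where "Suc j < length (C ! i)" "C ! i ! Suc j = u"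
        using route_mem_subtree[OF p(1), of v u] i by auto
      then show "u \<in> set (C ! i)" by (metis nth_mem)
    qed
    moreover have disj: "?S \<inter> (anc v - {r}) = {}"
      using anc_antisym[OF v] by (auto simp: subtree_def)
    moreover have "r \<notin> ?S" using root_not_in_subtree[of v] by auto
    ultimately have "?S \<union> (anc v - {r}) \<subseteq> set (C ! i) - {r}" by blast
    moreover have "0 \<le> wt u" if "u \<in> set (C ! i) - {r}" for u
      using that p(3) wt_pos[of u] by auto
    ultimately have "(\<Sum>u\<in>?S \<union> (anc v - {r}). wt u) \<le> (\<Sum>u\<in>set (C ! i) - {r}. wt u)"
      by (intro sum_mono2) auto
    moreover have "(\<Sum>u\<in>?S \<union> (anc v - {r}). wt u) = (\<Sum>u\<in>?S. wt u) + depth v"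
      using disj v by (subst sum.union_disjoint) (auto simp: depth_sum)
    ultimately show "(\<Sum>u\<in>?S. wt u) \<le> B / 2 - depth v"
      using route_length_ge[OF p(1)] p(2) by linarith
  qed
  also have "\<dots> = visits C v * (B / 2 - depth v)"
    by (simp add: visits_def)
  finally show ?thesis .
qed

text \<open>
  By induction each vertex \<open>u\<close> below \<open>v\<close> is visited at least \<open>1 + k\<^sub>u\<close> times, where \<open>k\<^sub>u\<close> counts
  the points \<open>z g\<close> in the subtree of \<open>u\<close>. Summing over these \<open>u\<close>, the contributions of a point \<open>z g\<close>
  amount to \<open>depth (z g) - depth v\<close>, and the hypothesis on \<open>v\<close> raises this to more than
  \<open>B / 2 - depth v\<close> per point, which is all that a single route can cover below \<open>v\<close>.
\<close>

lemma visits_gt_points: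
  assumes C: "exploration_strategy V E w r B C"
    and fin: "finite G"
    and pts: "\<And>v. v \<in> V \<Longrightarrow> \<exists>g\<in>G. z g \<in> subtree v \<Longrightarrow>
      (\<Sum>g\<in>{g \<in> G. z g \<in> subtree v}. B / 2 - depth (z g)) < weight_below v"
    and slack: "\<And>v. v \<in> V \<Longrightarrow> depth v \<le> B / 2"
    and v: "v \<in> V"
  shows "card {g \<in> G. z g \<in> subtree v} < visits C v"
  using v
proof (induction "card (subtree v)" arbitrary: v rule: less_induct)
  case less
  let ?K = "\<lambda>u. {g \<in> G. z g \<in> subtree u}"
  have cap: "(\<Sum>u\<in>subtree v - {v}. wt u * visits C u) \<le> visits C v * (B / 2 - depth v)"
    using visits_capacity C less.prems by (auto simp: exploration_strategy_def)
  show ?case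
  proof (cases "?K v = {}")
    case True
    \<comment> \<open>Without points the strict bound is just coverage: some route visits
      \<open>v\<close>.\<close>
    obtain p where "p \<in> set C" "v \<in> set p"
      using C less.prems by (auto simp: exploration_strategy_def)
    then have "{i. i < length C \<and> v \<in> set (C ! i)} \<noteq> {}"
      by (auto simp: in_set_conv_nth)
    then have "visits C v > 0" by (simp add: visits_def card_gt_0_iff)
    then show ?thesis by (simp only: True card.empty)
  next
    case False
    have IH: "1 + card (?K u) \<le> visits C u" if u: "u \<in> subtree v - {v}" for u
    proof -
      have "v \<notin> subtree u" using anc_antisym[of v u] u less.prems by (auto simp: subtree_def)
      then have "subtree u \<subset> subtree v"
        using u subtree_trans[of u v] subtree_self[OF less.prems] by blast
      then show ?thesis
        using less.hyps[of u] u subtree_subset psubset_card_mono[of "subtree v" "subtree u"]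
        by (auto simp: Suc_le_eq)
    qed
    have "card (?K v) * (B / 2 - depth v) =
      (\<Sum>g\<in>?K v. B / 2 - depth (z g)) + (\<Sum>g\<in>?K v. depth (z g) - depth v)"
      by (simp flip: sum.distrib)
    also have "\<dots> < weight_below v + (\<Sum>u\<in>subtree v - {v}. wt u * card (?K u))"
      using pts[OF less.prems] False sum_subtree_count[OF fin less.prems, of z] by auto
    also have "\<dots> = (\<Sum>u\<in>subtree v - {v}. wt u * (1 + card (?K u)))"
      by (simp add: weight_below_def ring_distribs sum.distrib)
    also have "\<dots> \<le> (\<Sum>u\<in>subtree v - {v}. wt u * visits C u)"
    proof (rule sum_mono)
      fix u assume u: "u \<in> subtree v - {v}"
      then have "0 \<le> wt u" by (rule wt_nonneg_below)
      moreover have "real (1 + card (?K u)) \<le> real (visits C u)"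
        using IH[OF u] by (rule of_nat_mono)
      ultimately show "wt u * real (1 + card (?K u)) \<le> wt u * real (visits C u)"
        by (rule mult_left_mono[rotated])
    qed
    also note cap
    finally have "card (?K v) * (B / 2 - depth v) < visits C v * (B / 2 - depth v)" .
    \<comment> \<open>The common factor is nonnegative, and the strict inequality excludes that it
      is zero.\<close>
    then have "real (card (?K v)) < real (visits C v)"
      using slack[OF less.prems] mult_less_cancel_right[of "real (card (?K v))" "B / 2 - depth v"] by auto
    then show ?thesis by simp
  qed
qed

end

section \<open>Depth first search\<close>

text \<open>\<open>zip p (tl p)\<close> is the list of directed steps of \<open>p\<close>. Its
  distinctness expresses that no edge is run through twice in the same direction.\<close>

lemma steps_append:
  "p \<noteq> [] \<Longrightarrow> q \<noteq> [] \<Longrightarrow>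
    zip (p @ q) (tl (p @ q)) = zip p (tl p) @ (last p, hd q) # zip q (tl q)"
proof (induction p rule: induct_list012)
  case (2 x)
  then show ?case by (cases q) auto
qed auto

lemma steps_subset: "set (zip p (tl p)) \<subseteq> set p \<times> set p"
proof
  fix e assume "e \<in> set (zip p (tl p))"
  then have "fst e \<in> set p" "snd e \<in> set (tl p)"
    by (auto simp: set_zip)
  then show "e \<in> set p \<times> set p" by (cases p; cases e) auto
qed

text \<open>A call meets no previously visited vertex but its own start. So the exploration from
  \<open>u\<close> avoids \<open>v\<close>, what follows avoids the vertices of \<open>R\<close>,
  and no directed step can recur.\<close>

lemma dfs_properties:
  assumes "dfs E X v R" and "v \<in> X"
  shows "R \<noteq> [] \<and> hd R = v \<and> last R = v \<and> set R \<inter> X = {v} \<and>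
    successively (\<lambda>a b. {a, b} \<in> E) R \<and> distinct (zip R (tl R))"
  using assms
proof (induction rule: dfs.induct)
  case (explore v u X R R')
  have R: "R \<noteq> []" "hd R = u" "last R = u" "set R \<inter> insert u X = {u}"
    "successively (\<lambda>a b. {a, b} \<in> E) R" "distinct (zip R (tl R))"
    and R': "R' \<noteq> []" "hd R' = v" "last R' = v" "set R' \<inter> (X \<union> set R) = {v}"
    "successively (\<lambda>a b. {a, b} \<in> E) R'" "distinct (zip R' (tl R'))"
    using explore.IH explore.prems by auto
  have vR: "v \<notin> set R" using R(4) explore.prems explore.hyps(2) by auto
  have uR: "u \<in> set R" using R(1,2) by (metis hd_in_set)
  have disj: "set R \<inter> set R' = {}" using R'(4) vR by auto
  have uR': "u \<notin> set R'" using disj uR by auto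
  have steps: "zip (v # R @ R') (tl (v # R @ R')) = (v, u) # zip R (tl R) @ (u, v) # zip R' (tl R')"
    using steps_append[of "[v]" "R @ R'"] steps_append[of R R'] R R' by simp
  have "set (zip R (tl R)) \<inter> set (zip R' (tl R')) = {}"
    "(v, u) \<notin> set (zip R (tl R))" "(v, u) \<notin> set (zip R' (tl R'))"
    "(u, v) \<notin> set (zip R (tl R))" "(u, v) \<notin> set (zip R' (tl R'))"
    using steps_subset[of R] steps_subset[of R'] disj vR uR' by blast+
  moreover have "u \<noteq> v" using vR uR by auto
  ultimately have "distinct (zip (v # R @ R') (tl (v # R @ R')))"
    unfolding steps using R(6) R'(6) by auto
  moreover have "successively (\<lambda>a b. {a, b} \<in> E) (v # R @ R')"
    using R R' explore.hyps(1) successively_append_iff[of "\<lambda>a b. {a, b} \<in> E" "[v]" "R @ R'"]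
    by (auto simp: successively_append_iff insert_commute)
  moreover have "set (v # R @ R') \<inter> X = {v}"
  proof -
    have "set R \<inter> X \<subseteq> {u}" using R(4) by blast
    then have "set R \<inter> X = {}" using explore.hyps(2) by blast
    moreover have "set R' \<inter> X \<subseteq> {v}" using R'(4) by blast
    ultimately show ?thesis using explore.prems by auto
  qed
  ultimately show ?case using R' by simp
qed auto

lemma successively_edges_subset:
  assumes "successively (\<lambda>a b. {a, b} \<in> E) p" and "p \<noteq> []" and "hd p \<in> V" and "\<forall>e\<in>E. e \<subseteq> V"
  shows "set p \<subseteq> V"
  using assms(1-3)
proof (induction p rule: induct_list012)
  case (3 x y p)
  then have "y \<in> V" using assms(4) by auto
  then show ?case using 3 by auto
qed auto

lemma walk_length_segment:
  assumes "a \<le> b"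
  shows "walk_length w (segment R a b) = (\<Sum>i\<in>{a..<b}. w {R ! i, R ! Suc i})"
proof -
  have "walk_length w (segment R a b) = (\<Sum>i<b - a. w {R ! (a + i), R ! Suc (a + i)})"
    using assms unfolding walk_length_def segment_def
    by (intro sum.cong) (auto simp del: upt_Suc)
  also have "\<dots> = (\<Sum>i\<in>{a..<b}. w {R ! i, R ! Suc i})"
    using assms sum.atLeastLessThan_shift_0[of "\<lambda>i. w {R ! i, R ! Suc i}" a b]
    by (simp add: lessThan_atLeast0 add.commute)
  finally show ?thesis .
qed

section \<open>Depth first traversal of a weighted tree\<close>

locale piecemeal_dfs = weighted_rooted_tree V E r w
  for V :: "'a set" and E :: "'a set set" and r :: 'a and w :: "'a set \<Rightarrow> real" +
  fixes B :: real and R :: "'a list"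
  assumes depth_le: "v \<in> V \<Longrightarrow> depth v \<le> B / 2"
    and dfs: "dfs_traversal E r R"
begin

abbreviation l :: nat where "l \<equiv> length R - 1"

abbreviation J :: "nat \<Rightarrow> nat" where "J \<equiv> pdfs_index V E w r B R"

abbreviation len :: "nat \<Rightarrow> nat \<Rightarrow> real" where
  "len a b \<equiv> \<Sum>i\<in>{a..<b}. w {R ! i, R ! Suc i}"

declare pdfs_index.simps(2) [simp del]

lemma R_route: "route V E r R" and R_distinct_steps: "distinct (zip R (tl R))"
proof -
  have p: "R \<noteq> []" "hd R = r" "last R = r" "successively (\<lambda>a b. {a, b} \<in> E) R"
    "distinct (zip R (tl R))"
    using dfs dfs_properties[of E "{r}" r R] by (auto simp: dfs_traversal_def)
  moreover have "set R \<subseteq> V"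
    using p tree by (intro successively_edges_subset) (auto simp: tree_def)
  ultimately show "route V E r R" "distinct (zip R (tl R))"
    by (auto simp: route_def walk_def)
qed

lemma R_walk: "walk V E R" and R_ne: "R \<noteq> []"
  and R_first [simp]: "R ! 0 = r" and R_last: "R ! l = r"
  using R_route by (auto simp: route_def walk_def hd_conv_nth last_conv_nth)

lemma less_length: "i \<le> l \<Longrightarrow> i < length R"
  using R_ne by (cases R) auto

lemma R_in_V: "i \<le> l \<Longrightarrow> R ! i \<in> V"
  using less_length R_walk by (auto simp: walk_def)

lemma step_unique:
  assumes "i < l" and "j < l" and "R ! i = R ! j" and "R ! Suc i = R ! Suc j"
  shows "i = j"
proof -
  have "zip R (tl R) ! i = zip R (tl R) ! j"
    using assms by (simp add: nth_tl)
  then show ?thesis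
    using R_distinct_steps assms nth_eq_iff_index_eq[of "zip R (tl R)" i j] by simp
qed

text \<open>Unless \<open>v = r\<close>, the traversal starts outside the subtree, so leaving it and
  coming back would repeat the step from the parent of \<open>v\<close> down to
  \<open>v\<close>.\<close>

lemma subtree_visits_contiguous:
  assumes "a \<le> t" and "t \<le> b" and "b \<le> l" and "R ! a \<in> subtree v" and "R ! b \<in> subtree v"
  shows "R ! t \<in> subtree v"
proof (rule ccontr)
  assume t: "R ! t \<notin> subtree v"
  then have "v \<noteq> r" using R_in_V[of t] assms subtree_root by auto
  then have "R ! 0 \<notin> subtree v" using root_not_in_subtree by simp
  then obtain i where i: "i < a" "R ! Suc i = v" "parent v = R ! i"
    using walk_into_subtree[OF R_walk, of 0 a v] assms less_length[of a] by auto
  obtain j where j: "t \<le> j" "j < b" "R ! Suc j = v" "parent v = R ! j"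
    using walk_into_subtree[OF R_walk, of t b v] assms less_length[of b] t by auto
  show False using step_unique[of i j] i j assms by simp
qed

text \<open>Downward steps within the subtree end in different vertices below \<open>v\<close>:
  equal ends have equal parents, which makes the steps the same.\<close>

lemma sum_descent_le:
  assumes "S \<subseteq> {..<l}" and S: "\<And>t. t \<in> S \<Longrightarrow> R ! t \<in> subtree v \<and> R ! Suc t \<in> subtree v"
  shows "(\<Sum>t\<in>S. descent R t) \<le> weight_below v"
proof -
  let ?D = "{t \<in> S. down R t}"
  have fin: "finite S" using assms(1) by (rule finite_subset) simp
  have "inj_on (\<lambda>t. R ! Suc t) ?D"
    using assms(1) by (intro inj_onI step_unique) (auto simp: down_def)
  moreover have "(\<lambda>t. R ! Suc t) ` ?D \<subseteq> subtree v - {v}"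
  proof clarify
    fix t assume t: "t \<in> S" "down R t"
    show "R ! Suc t \<in> subtree v - {v}"
      using parent_in_subtree[of "R ! Suc t" v] S[OF t(1)] t(2) subtree_subset
      by (auto simp: down_def)
  qed
  moreover have "(\<Sum>t\<in>S. descent R t) = (\<Sum>t\<in>?D. wt (R ! Suc t))"
    unfolding descent_def using fin by (simp add: sum.If_cases Int_def)
  moreover have "0 \<le> wt u" if "u \<in> subtree v - {v}" for u
    using that by (rule wt_nonneg_below)
  ultimately show ?thesis
    unfolding weight_below_def
    using sum_mono2[of "subtree v - {v}" "(\<lambda>t. R ! Suc t) ` ?D" wt] by (simp add: sum.reindex)
qed

lemma sum_ascent_le:
  assumes "S \<subseteq> {..<l}" and S: "\<And>t. t \<in> S \<Longrightarrow> R ! t \<in> subtree v \<and> R ! Suc t \<in> subtree v"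
  shows "(\<Sum>t\<in>S. ascent R t) \<le> weight_below v"
proof -
  let ?D = "{t \<in> S. up R t}"
  have fin: "finite S" using assms(1) by (rule finite_subset) simp
  have "inj_on (\<lambda>t. R ! t) ?D"
    using assms(1) by (intro inj_onI step_unique) (auto simp: up_def)
  moreover have "(\<lambda>t. R ! t) ` ?D \<subseteq> subtree v - {v}"
  proof clarify
    fix t assume t: "t \<in> S" "up R t"
    show "R ! t \<in> subtree v - {v}"
      using parent_in_subtree[of "R ! t" v] S[OF t(1)] t(2) subtree_subset
      by (auto simp: up_def)
  qed
  moreover have "(\<Sum>t\<in>S. ascent R t) = (\<Sum>t\<in>?D. wt (R ! t))"
    unfolding ascent_def using fin by (simp add: sum.If_cases Int_def)
  moreover have "0 \<le> wt u" if "u \<in> subtree v - {v}" for u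
    using that by (rule wt_nonneg_below)
  ultimately show ?thesis
    unfolding weight_below_def
    using sum_mono2[of "subtree v - {v}" "(\<lambda>t. R ! t) ` ?D" wt] by (simp add: sum.reindex)
qed

subsection \<open>The indices of the DFS exploration\<close>

text \<open>Going to \<open>R ! J i\<close> and straight back costs at most \<open>B\<close>, so the
  finite set under \<open>Max\<close> contains \<open>J i\<close> and the maximum is
  attained.\<close>

lemma
  assumes "J i \<le> l"
  shows J_Suc_bounds: "J i \<le> J (Suc i)" "J (Suc i) \<le> l"
    and J_Suc_max: "\<And>p. J i \<le> p \<Longrightarrow> p \<le> l \<Longrightarrow>
      depth (R ! J i) + len (J i) p + depth (R ! p) \<le> B \<Longrightarrow> p \<le> J (Suc i)"
proof -
  let ?S = "{p. J i \<le> p \<and> p \<le> l \<and>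
    tree_dist V E w r (R ! J i) + walk_length w (segment R (J i) p) + tree_dist V E w (R ! p) r \<le> B}"
  have iff: "p \<in> ?S \<longleftrightarrow> J i \<le> p \<and> p \<le> l \<and> depth (R ! J i) + len (J i) p + depth (R ! p) \<le> B" for p
    using R_in_V[of p] by (auto simp: walk_length_segment tree_dist_to_root depth_def[symmetric])
  have J: "J (Suc i) = Max ?S" by (simp add: Let_def pdfs_index.simps(2))
  have fin: "finite ?S" by (rule finite_subset[of _ "{..l}"]) auto
  have "J i \<in> ?S"
    unfolding iff using assms depth_le[OF R_in_V[OF assms]] by simp
  then have "Max ?S \<in> ?S" using Max_in[OF fin] by blast
  then show "J i \<le> J (Suc i)" "J (Suc i) \<le> l" unfolding J by auto
  show "p \<le> J (Suc i)" if "J i \<le> p" "p \<le> l" "depth (R ! J i) + len (J i) p + depth (R ! p) \<le> B" for p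
    unfolding J using that by (intro Max_ge fin) (simp only: iff)
qed

lemma J_le: "J i \<le> l"
proof (induction i)
  case (Suc i)
  then show ?case by (rule J_Suc_bounds(2))
qed simp

lemma J_mono: "i \<le> j \<Longrightarrow> J i \<le> J j"
  using J_Suc_bounds(1)[OF J_le] by (rule lift_Suc_mono_le)

lemma J_step:
  assumes "J i < l"
  shows "J i < J (Suc i)"
proof -
  have i: "Suc (J i) < length R" using assms by simp
  then have V: "R ! J i \<in> V" "R ! Suc (J i) \<in> V" using R_in_V by auto
  have "len (J i) (Suc (J i)) = descent R (J i) + ascent R (J i)"
    using step_weight[OF R_walk i] by simp
  \<comment> \<open>One of descent and ascent vanishes, so the left side is twice the larger of the
    two depths.\<close>
  then have "depth (R ! J i) + len (J i) (Suc (J i)) + depth (R ! Suc (J i)) \<le> B"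
    using step_depth[OF R_walk i] step_one_way[OF R_walk i] depth_le[OF V(1)] depth_le[OF V(2)] by linarith
  then show ?thesis
    using J_Suc_max[OF J_le, of i "Suc (J i)"] assms by simp
qed

lemma J_strict: "i < j \<Longrightarrow> J i < l \<Longrightarrow> J i < J j"
  using J_step[of i] J_mono[of "Suc i" j] by simp

text \<open>
  A segment of the exploration is maximal, so by one more step it would exceed the bound. Since
  descent minus ascent is the change of depth, each of the two is bounded separately.
\<close>

lemma
  assumes "J (Suc i) < l"
  shows descent_overflow:
      "B / 2 - depth (R ! J i) < (\<Sum>t\<in>{J i..<Suc (J (Suc i))}. descent R t)"
    and ascent_overflow:
      "B / 2 - depth (R ! Suc (J (Suc i))) < (\<Sum>t\<in>{J i..<Suc (J (Suc i))}. ascent R t)"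
proof -
  let ?c = "Suc (J (Suc i))"
  have c: "?c < length R" "J i \<le> ?c" using assms J_mono[of i "Suc i"] by auto
  have "B < depth (R ! J i) + len (J i) ?c + depth (R ! ?c)"
    using J_Suc_max[OF J_le, of i ?c] assms c by (meson Suc_leI leI not_less_eq_eq order_refl)
  then show "B / 2 - depth (R ! J i) < (\<Sum>t\<in>{J i..<?c}. descent R t)"
    "B / 2 - depth (R ! ?c) < (\<Sum>t\<in>{J i..<?c}. ascent R t)"
    using walk_weight[OF R_walk c(1), of "J i"] walk_depth[OF R_walk c(2,1)] by argo+
qed

text \<open>The number of routes. The condition \<open>k \<ge> 1\<close> matters for the tree with a
  single vertex, where already \<open>J 0 = l\<close>.\<close>

definition K :: nat where "K = (LEAST k. k \<ge> 1 \<and> J k = l)"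

lemma K_ge_1: "1 \<le> K" and J_K [simp]: "J K = l"
proof -
  \<comment> \<open>The indices grow by at least one until they reach \<open>l\<close>. The witness
    \<open>Suc l\<close> is positive even if \<open>l = 0\<close>.\<close>
  have "min i l \<le> J i" for i
  proof (induction i)
    case (Suc i)
    then show ?case
      using J_step[of i] J_mono[of i "Suc i"] J_le[of i] by (cases "J i < l") auto
  qed simp
  from this[of "Suc l"] have "Suc l \<ge> 1 \<and> J (Suc l) = l"
    using J_le[of "Suc l"] by simp
  then have "1 \<le> K \<and> J K = l" unfolding K_def by (rule LeastI)
  then show "1 \<le> K" "J K = l" by auto
qed

lemma J_less_l: "1 \<le> i \<Longrightarrow> i < K \<Longrightarrow> J i < l"
  using not_less_Least[of i "\<lambda>k. k \<ge> 1 \<and> J k = l"] J_le[of i] by (auto simp: K_def)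

subsection \<open>Groups of three consecutive segments\<close>

text \<open>Group \<open>g\<close> consists of the two segments between the breaks
  \<open>3 * g\<close> and \<open>3 * g + 2\<close> and one more step. That step makes the second
  segment overflow; it belongs to the third segment, so the groups do not overlap.\<close>

definition first :: "nat \<Rightarrow> nat" where "first g = J (3 * g)"

definition final :: "nat \<Rightarrow> nat" where "final g = Suc (J (3 * g + 2))"

text \<open>An index rather than a vertex, since \<open>group_gain\<close> depends on which side of
  the middle break it lies.\<close>

definition apex :: "nat \<Rightarrow> nat" where
  "apex g = arg_min_on (\<lambda>t. depth (R ! t)) {first g..final g}"

lemma group_bounds:
  assumes "3 * g + 2 < K"
  shows "first g \<le> J (3 * g + 1)" "J (3 * g + 1) < final g" "final g \<le> l"
  using J_mono[of "3 * g" "3 * g + 1"] J_mono[of "3 * g + 1" "3 * g + 2"]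
    J_less_l[of "3 * g + 2"] assms by (auto simp: first_def final_def)

lemma
  assumes "3 * g + 2 < K"
  shows apex_bounds: "first g \<le> apex g" "apex g \<le> final g"
    and apex_min: "\<And>t. first g \<le> t \<Longrightarrow> t \<le> final g \<Longrightarrow> depth (R ! apex g) \<le> depth (R ! t)"
proof -
  have ne: "{first g..final g} \<noteq> {}" using group_bounds[OF assms] by simp
  show "first g \<le> apex g" "apex g \<le> final g"
    using arg_min_if_finite(1)[OF _ ne] unfolding apex_def by auto
  show "depth (R ! apex g) \<le> depth (R ! t)" if "first g \<le> t" "t \<le> final g" for t
    using arg_min_if_finite(2)[OF _ ne, of "\<lambda>t. depth (R ! t)"] that
    unfolding apex_def by (meson atLeastAtMost_iff finite_atLeastAtMost not_less)
qed

text \<open>Entering or leaving the subtree of the apex vertex would put its parent into the group,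
  and the parent is less deep than the minimum.\<close>

lemma group_in_subtree:
  assumes "3 * g + 2 < K" and t: "first g \<le> t" "t \<le> final g"
  shows "R ! t \<in> subtree (R ! apex g)"
proof (rule ccontr)
  assume nin: "R ! t \<notin> subtree (R ! apex g)"
  note b = group_bounds[OF assms(1)] and tb = apex_bounds[OF assms(1)]
    and min = apex_min[OF assms(1)]
  have V: "R ! apex g \<in> V" using R_in_V tb b by simp
  have self: "R ! apex g \<in> subtree (R ! apex g)" using V by (rule subtree_self)
  have "\<exists>i. first g \<le> i \<and> i \<le> final g \<and> R ! apex g \<noteq> r \<and> parent (R ! apex g) = R ! i"
  proof (cases "t \<le> apex g")
    case True
    then obtain i where "t \<le> i" "i < apex g" "R ! apex g \<noteq> r" "parent (R ! apex g) = R ! i"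
      using walk_into_subtree[OF R_walk True _ nin self] less_length tb b by auto
    then show ?thesis using t tb by (intro exI[of _ i]) auto
  next
    case False
    then have "apex g \<le> t" by simp
    then obtain i where "apex g \<le> i" "i < t" "R ! apex g \<noteq> r" "parent (R ! apex g) = R ! Suc i"
      using walk_out_of_subtree[OF R_walk _ _ self nin] less_length t b by auto
    then show ?thesis using t tb by (intro exI[of _ "Suc i"]) auto
  qed
  then show False
    using min V depth_parent wt_pos by fastforce
qed

text \<open>
  Depending on whether the highest vertex of the group is reached before or after the middle break,
  the walk descends from there to the break, or ascends to there from the vertex next to the break.
  The overflow of the other segment supplies what is missing.
\<close>

lemma group_gain:
  assumes g: "3 * g + 2 < K"
  shows "B / 2 - depth (R ! apex g) < (\<Sum>t\<in>{first g..<final g}. ascent R t) \<or>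
    B / 2 - depth (R ! apex g) < (\<Sum>t\<in>{first g..<final g}. descent R t)"
proof -
  let ?b = "J (3 * g + 1)"
  note bd = group_bounds[OF g] and tb = apex_bounds[OF g]
  have len: "final g < length R" using bd less_length by simp
  have nn: "0 \<le> descent R t" "0 \<le> ascent R t" if "t < final g" for t
    using descent_nonneg[OF R_walk] ascent_nonneg[OF R_walk] that len by auto
  show ?thesis
  proof (cases "apex g \<le> ?b")
    case True
    have "B / 2 - depth (R ! ?b) < (\<Sum>t\<in>{?b..<final g}. descent R t)"
      using descent_overflow[of "3 * g + 1"] J_less_l[of "3 * g + 2"] g by (simp add: final_def)
    moreover have "depth (R ! ?b) - depth (R ! apex g) \<le> (\<Sum>t\<in>{apex g..<?b}. descent R t)"
    proof -
      have "0 \<le> (\<Sum>t\<in>{apex g..<?b}. ascent R t)"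
        using nn bd by (intro sum_nonneg) auto
      then show ?thesis using walk_depth[OF R_walk True] bd len by simp
    qed
    moreover have "(\<Sum>t\<in>{apex g..<?b}. descent R t) + (\<Sum>t\<in>{?b..<final g}. descent R t)
        \<le> (\<Sum>t\<in>{first g..<final g}. descent R t)"
      using True bd tb nn by (subst sum.atLeastLessThan_concat) (auto intro!: sum_mono2)
    ultimately show ?thesis by linarith
  next
    case False
    then have tp: "Suc ?b \<le> apex g" by simp
    have "B / 2 - depth (R ! Suc ?b) < (\<Sum>t\<in>{first g..<Suc ?b}. ascent R t)"
      using ascent_overflow[of "3 * g"] J_less_l[of "3 * g + 1"] g by (simp add: first_def)
    moreover have "depth (R ! Suc ?b) - depth (R ! apex g) \<le> (\<Sum>t\<in>{Suc ?b..<apex g}. ascent R t)"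
    proof -
      have "0 \<le> (\<Sum>t\<in>{Suc ?b..<apex g}. descent R t)"
        using nn tb by (intro sum_nonneg) auto
      then show ?thesis using walk_depth[OF R_walk tp] tb len by simp
    qed
    moreover have "(\<Sum>t\<in>{first g..<Suc ?b}. ascent R t) + (\<Sum>t\<in>{Suc ?b..<apex g}. ascent R t)
        \<le> (\<Sum>t\<in>{first g..<final g}. ascent R t)"
      using tp bd tb nn by (subst sum.atLeastLessThan_concat) (auto intro!: sum_mono2)
    ultimately show ?thesis by linarith
  qed
qed

text \<open>Before the end of the traversal the third segment is nonempty, so the additional step of
  group \<open>g\<close> ends no later than break \<open>3 * g + 3\<close>.\<close>

lemma groups_disjoint:
  assumes "g < h"
  shows "{first g..<final g} \<inter> {first h..<final h} = {} \<or> \<not> 3 * h + 2 < K"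
proof (cases "3 * h + 2 < K")
  case True
  then have "final g \<le> J (3 * g + 3)"
    using J_strict[of "3 * g + 2" "3 * g + 3"] J_less_l[of "3 * g + 2"] assms
    by (simp add: final_def)
  also have "\<dots> \<le> first h" unfolding first_def using assms by (intro J_mono) simp
  finally show ?thesis by auto
qed simp

text \<open>Here \<open>f\<close> stands for \<open>ascent R\<close> or \<open>descent R\<close>.
  The groups are disjoint and each stays in the subtree of its apex, so the values
  \<open>B / 2 - depth (R ! apex g)\<close> for the apices below \<open>u\<close> sum to less than
  \<open>weight_below u\<close>, as \<open>visits_gt_points\<close> demands.\<close>

lemma groups_lt_visits:
  assumes C: "exploration_strategy V E w r B C" and v: "v \<in> V"
    and f: "\<And>S u. S \<subseteq> {..<l} \<Longrightarrow> (\<And>t. t \<in> S \<Longrightarrow> R ! t \<in> subtree u \<and> R ! Suc t \<in> subtree u) \<Longrightarrow>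
      (\<Sum>t\<in>S. f t) \<le> weight_below u"
  shows "card {g \<in> {g. 3 * g + 2 < K \<and> B / 2 - depth (R ! apex g) < (\<Sum>t\<in>{first g..<final g}. f t)}.
    R ! apex g \<in> subtree v} < visits C v"
proof (rule visits_gt_points[OF C _ _ depth_le v])
  let ?G = "{g. 3 * g + 2 < K \<and> B / 2 - depth (R ! apex g) < (\<Sum>t\<in>{first g..<final g}. f t)}"
  show fin: "finite ?G" by (rule finite_subset[of _ "{..<K}"]) auto
  fix u assume u: "u \<in> V" "\<exists>g\<in>?G. R ! apex g \<in> subtree u"
  let ?H = "{g \<in> ?G. R ! apex g \<in> subtree u}"
  have finH: "finite ?H" by (rule finite_subset[OF _ fin]) auto
  have "(\<Sum>g\<in>?H. B / 2 - depth (R ! apex g)) < (\<Sum>g\<in>?H. \<Sum>t\<in>{first g..<final g}. f t)"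
    using u(2) finH by (intro sum_strict_mono) auto
  also have "\<dots> = (\<Sum>t\<in>(\<Union>g\<in>?H. {first g..<final g}). f t)"
  proof (rule sum.UNION_disjoint[symmetric])
    show "\<forall>g\<in>?H. \<forall>h\<in>?H. g \<noteq> h \<longrightarrow> {first g..<final g} \<inter> {first h..<final h} = {}"
      using groups_disjoint by (metis (no_types, lifting) Int_commute linorder_neqE_nat mem_Collect_eq)
  qed (use finH in auto)
  also have "\<dots> \<le> weight_below u"
  proof (rule f)
    show "(\<Union>g\<in>?H. {first g..<final g}) \<subseteq> {..<l}"
      using group_bounds(3) by fastforce
    fix t assume "t \<in> (\<Union>g\<in>?H. {first g..<final g})"
    then obtain g where g: "3 * g + 2 < K" "R ! apex g \<in> subtree u" "first g \<le> t" "t < final g"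
      by auto
    then show "R ! t \<in> subtree u \<and> R ! Suc t \<in> subtree u"
      using group_in_subtree[of g t] group_in_subtree[of g "Suc t"] subtree_trans by auto
  qed
  finally show "(\<Sum>g\<in>?H. B / 2 - depth (R ! apex g)) < weight_below u" .
qed

text \<open>Every group between the first and the last break below \<open>v\<close> has its apex
  there as well, and it counts for ascent or for descent. Each of these two counts is less than
  \<open>visits C v\<close>.\<close>

lemma breaks_le_visits:
  assumes C: "exploration_strategy V E w r B C" and v: "v \<in> V"
  shows "card {i \<in> {1..<K}. R ! J i \<in> subtree v} + 1 \<le> 6 * visits C v"
proof -
  let ?M = "{i \<in> {1..<K}. R ! J i \<in> subtree v}"
  let ?A = "{g \<in> {g. 3 * g + 2 < K \<and>
    B / 2 - depth (R ! apex g) < (\<Sum>t\<in>{first g..<final g}. ascent R t)}. R ! apex g \<in> subtree v}"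
  let ?D = "{g \<in> {g. 3 * g + 2 < K \<and>
    B / 2 - depth (R ! apex g) < (\<Sum>t\<in>{first g..<final g}. descent R t)}. R ! apex g \<in> subtree v}"
  have A: "card ?A < visits C v"
    using C v sum_ascent_le by (rule groups_lt_visits)
  have D: "card ?D < visits C v"
    using C v sum_descent_le by (rule groups_lt_visits)
  show ?thesis
  proof (cases "?M = {}")
    case True
    then have "card ?M = 0" by (simp only: card.empty)
    then show ?thesis using A by linarith
  next
    case False
    have finM: "finite ?M" by simp
    define lo hi where "lo = Min ?M" and "hi = Max ?M"
    have lo: "lo \<in> ?M" unfolding lo_def by (rule Min_in[OF finM False])
    have hi: "hi \<in> ?M" unfolding hi_def by (rule Max_in[OF finM False])
    have "?M \<subseteq> {lo..hi}" unfolding lo_def hi_def using finM by auto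
    then have cM: "card ?M \<le> hi + 1 - lo" using card_mono[of "{lo..hi}" ?M] by simp
    \<comment> \<open>\<open>(lo + 2) div 3\<close> is \<open>lo / 3\<close> rounded up. The range
      consists of the groups that start at break \<open>lo\<close> or later and whose third segment
      ends by break \<open>hi\<close>.\<close>
    have sub: "{(lo + 2) div 3..<hi div 3} \<subseteq> ?A \<union> ?D"
    proof
      fix g assume "g \<in> {(lo + 2) div 3..<hi div 3}"
      then have g: "lo \<le> 3 * g" "3 * g + 3 \<le> hi" by auto
      then have gK: "3 * g + 2 < K" using hi by auto
      have "J lo \<le> first g" unfolding first_def using g by (intro J_mono)
      moreover have "final g \<le> J hi"
        unfolding final_def using J_strict[of "3 * g + 2" hi] J_less_l[of "3 * g + 2"] g gK by simp
      ultimately have "R ! apex g \<in> subtree v"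
        using subtree_visits_contiguous[of "J lo" "apex g" "J hi" v] apex_bounds[OF gK] J_le lo hi by auto
      then show "g \<in> ?A \<union> ?D" using group_gain[OF gK] gK by auto
    qed
    have finA: "finite ?A" "finite ?D"
      by (rule finite_subset[of _ "{..<K}"]; auto)+
    have "hi div 3 - (lo + 2) div 3 \<le> card (?A \<union> ?D)"
      using card_mono[OF _ sub] finA by simp
    also have "\<dots> \<le> card ?A + card ?D" by (rule card_Un_le)
    \<comment> \<open>Let \<open>n\<close> be the number of groups in the range. Rounding gives
      \<open>hi - lo \<le> 3 * n + 4\<close>, hence \<open>card ?M \<le> 3 * n + 5\<close>, and
      \<open>n \<le> 2 * (visits C v - 1)\<close> turns this into
      \<open>6 * visits C v - 1\<close>.\<close>
    finally show ?thesis using A D cM by linarith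
  qed
qed

subsection \<open>The cost of the DFS exploration\<close>

lemma pdfs_route_length:
  "walk_length w (pdfs_route V E w r B R (Suc i)) =
    depth (R ! J i) + len (J i) (J (Suc i)) + depth (R ! J (Suc i))"
proof -
  let ?a = "J i" and ?b = "J (Suc i)"
  have ab: "?a \<le> ?b" using J_mono by simp
  have V: "R ! ?a \<in> V" "R ! ?b \<in> V" using R_in_V J_le by auto
  let ?p = "tree_path V E r (R ! ?a)" and ?s = "segment R ?a ?b" and ?q = "tree_path V E (R ! ?b) r"
  have p: "?p \<noteq> []" "last ?p = R ! ?a" and q: "?q \<noteq> []" "hd ?q = R ! ?b"
    using path_between_tree_path[of r "R ! ?a"] path_between_tree_path[of "R ! ?b" r] V
    by (auto simp: path_between_def walk_def)
  have s: "?s \<noteq> []" "hd ?s = R ! ?a" "last ?s = R ! ?b"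
    using ab by (auto simp: segment_def hd_map last_map simp del: upt_Suc)
  have "last (?p @ tl ?s) = R ! ?b"
    using p s by (cases ?s) (auto split: if_splits)
  then have "walk_length w ((?p @ tl ?s) @ tl ?q) = walk_length w ?p + walk_length w ?s + walk_length w ?q"
    using walk_length_append_tl[of "?p @ tl ?s" ?q w] walk_length_append_tl[of ?p ?s w] p q s by simp
  moreover have "walk_length w ?p = depth (R ! ?a)" by (simp add: depth_def tree_dist_def)
  moreover have "walk_length w ?q = depth (R ! ?b)"
    using tree_dist_to_root[OF V(2)] by (simp add: tree_dist_def)
  moreover have "pdfs_route V E w r B R (Suc i) = (?p @ tl ?s) @ tl ?q"
    by (simp add: pdfs_route_def Let_def)
  ultimately show ?thesis using walk_length_segment[OF ab] by simp
qed

text \<open>The depth of an inner break is paid at the end of one route and at the start of the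
  next. The outer breaks \<open>J 0\<close> and \<open>J K\<close> lie at the root.\<close>

lemma cost_PDFS:
  "cost w (PDFS V E w r B R) = len 0 l + 2 * (\<Sum>i\<in>{1..<K}. depth (R ! J i))"
proof -
  have "cost w (PDFS V E w r B R) = (\<Sum>i\<leftarrow>[1..<Suc K]. walk_length w (pdfs_route V E w r B R i))"
    by (simp add: cost_def PDFS_def K_def Let_def comp_def del: upt_Suc)
  also have "\<dots> = (\<Sum>i\<in>{Suc 0..<Suc K}. walk_length w (pdfs_route V E w r B R i))"
    by (simp only: interv_sum_list_conv_sum_set_nat set_upt One_nat_def)
  also have "\<dots> = (\<Sum>i\<in>{0..<K}. walk_length w (pdfs_route V E w r B R (Suc i)))"
    by (rule sum.shift_bounds_Suc_ivl)
  also have "\<dots> = (\<Sum>i\<in>{0..<K}. depth (R ! J i) + len (J i) (J (Suc i)) + depth (R ! J (Suc i)))"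
    by (simp only: pdfs_route_length)
  also have "\<dots> = len 0 (J K) + (\<Sum>i\<in>{0..<K}. depth (R ! J i)) + (\<Sum>i\<in>{0..<K}. depth (R ! J (Suc i)))"
  proof -
    have "(\<Sum>i\<in>{0..<k}. len (J i) (J (Suc i))) = len 0 (J k)" for k
    proof (induction k)
      case (Suc k)
      have "len 0 (J k) + len (J k) (J (Suc k)) = len 0 (J (Suc k))"
        using J_mono[of k "Suc k"] by (intro sum.atLeastLessThan_concat) auto
      then show ?case using Suc by (simp)
    qed simp
    then show ?thesis by (simp add: sum.distrib)
  qed
  also have "(\<Sum>i\<in>{0..<K}. depth (R ! J i)) = (\<Sum>i\<in>{1..<K}. depth (R ! J i))"
    using K_ge_1 by (simp add: sum.atLeast_Suc_lessThan)
  also have "(\<Sum>i\<in>{0..<K}. depth (R ! J (Suc i))) = (\<Sum>i\<in>{1..<Suc K}. depth (R ! J i))"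
    by (simp only: sum.shift_bounds_Suc_ivl One_nat_def)
  also have "\<dots> = (\<Sum>i\<in>{1..<K}. depth (R ! J i))"
    using K_ge_1 R_last by simp
  finally show ?thesis by simp
qed

text \<open>The edge above \<open>u\<close> is charged at most twice for the traversal and twice for
  each break below \<open>u\<close>. The spare 1 in \<open>breaks_le_visits\<close> absorbs the
  traversal.\<close>

lemma cost_PDFS_le:
  assumes "exploration_strategy V E w r B C"
  shows "cost w (PDFS V E w r B R) \<le> 6 * cost w C"
proof -
  let ?m = "\<lambda>u. card {i \<in> {1..<K}. R ! J i \<in> subtree u}"
  have below_root: "weight_below r = (\<Sum>u\<in>V - {r}. wt u)"
    by (simp add: weight_below_def subtree_root)
  have in_root: "R ! t \<in> subtree r \<and> R ! Suc t \<in> subtree r" if "t \<in> {0..<l}" for t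
    using that R_in_V by (simp add: subtree_root)
  have "len 0 l = (\<Sum>t\<in>{0..<l}. descent R t) + (\<Sum>t\<in>{0..<l}. ascent R t)"
    using walk_weight[OF R_walk, of l 0] less_length by simp
  also have "\<dots> \<le> 2 * (\<Sum>u\<in>V - {r}. wt u)"
    using sum_descent_le[of "{0..<l}" r] sum_ascent_le[of "{0..<l}" r] in_root below_root by fastforce
  finally have len: "len 0 l \<le> 2 * (\<Sum>u\<in>V - {r}. wt u)" .
  have "{i \<in> {1..<K}. R ! J i \<in> subtree r} = {1..<K}"
    using R_in_V J_le by (auto simp: subtree_root)
  \<comment> \<open>Taken at the root, \<open>sum_subtree_count\<close> distributes the depths of
    the breaks over the edges.\<close>
  then have "(\<Sum>i\<in>{1..<K}. depth (R ! J i)) = (\<Sum>u\<in>V - {r}. wt u * ?m u)"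
    using sum_subtree_count[of "{1..<K}" r "\<lambda>i. R ! J i"] by (simp add: subtree_root)
  then have "cost w (PDFS V E w r B R) \<le> 2 * (\<Sum>u\<in>V - {r}. wt u) + 2 * (\<Sum>u\<in>V - {r}. wt u * ?m u)"
    using len cost_PDFS by simp
  also have "\<dots> = 2 * (\<Sum>u\<in>V - {r}. wt u * real (?m u + 1))"
    by (simp add: ring_distribs sum.distrib)
  also have "\<dots> \<le> 2 * (\<Sum>u\<in>V - {r}. wt u * real (6 * visits C u))"
  proof -
    have "wt u * real (?m u + 1) \<le> wt u * real (6 * visits C u)" if "u \<in> V - {r}" for u
    proof (rule mult_left_mono)
      show "real (?m u + 1) \<le> real (6 * visits C u)"
        using that breaks_le_visits[OF assms, of u] by (intro of_nat_mono) simp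
      show "0 \<le> wt u" using that wt_pos[of u] by simp
    qed
    then show ?thesis by (intro mult_left_mono[OF sum_mono]) auto
  qed
  also have "\<dots> = 6 * (2 * (\<Sum>u\<in>V - {r}. wt u * visits C u))"
    by (simp add: sum_distrib_left mult_ac)
  also have "\<dots> \<le> 6 * cost w C"
    using cost_ge_sum_visits[of C] assms by (simp add: exploration_strategy_def)
  finally show ?thesis .
qed

end

theorem theorem2:
  fixes V :: "'a set" and E :: "'a set set" and w :: "'a set \<Rightarrow> real" and r :: 'a
    and B :: real and R\<^sub>D\<^sub>F\<^sub>S :: "'a list" and C\<^sub>o\<^sub>p\<^sub>t :: "'a list list"
  assumes "tree V E" and "finite V" and "r \<in> V"
    and "\<forall>e\<in>E. w e > 0"
    and "B > 1"
    and "\<forall>v\<in>V. tree_dist V E w r v \<le> B / 2"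
    and "dfs_traversal E r R\<^sub>D\<^sub>F\<^sub>S"
    and "optimal_strategy V E w r B C\<^sub>o\<^sub>p\<^sub>t"
  shows "cost w (PDFS V E w r B R\<^sub>D\<^sub>F\<^sub>S) \<le> 10 * cost w C\<^sub>o\<^sub>p\<^sub>t"
proof -
  interpret weighted_rooted_tree V E r w
    using assms by unfold_locales auto
  interpret piecemeal_dfs V E r w B R\<^sub>D\<^sub>F\<^sub>S
    using assms by unfold_locales (auto simp: depth_def)
  have C: "exploration_strategy V E w r B C\<^sub>o\<^sub>p\<^sub>t"
    using assms(8) by (simp add: optimal_strategy_def is_arg_min_def)
  \<comment> \<open>Weakening the factor 6 to 10 requires the cost to be nonnegative.\<close>
  have "0 \<le> wt u * visits C\<^sub>o\<^sub>p\<^sub>t u" if "u \<in> V - {r}" for u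
    using that wt_pos[of u] by simp
  then have "0 \<le> (\<Sum>u\<in>V - {r}. wt u * visits C\<^sub>o\<^sub>p\<^sub>t u)"
    by (rule sum_nonneg)
  then have "0 \<le> cost w C\<^sub>o\<^sub>p\<^sub>t"
    using cost_ge_sum_visits[of C\<^sub>o\<^sub>p\<^sub>t] C by (force simp: exploration_strategy_def)
  then show ?thesis using cost_PDFS_le[OF C] by linarith
qed

end
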